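(* Let $\lambda$ be a nonzero real number. For every $k\in\mathbb{N}$ (that is, $k\ge1$), as formal power series in $x$, $$\sum_{n=1}^{\infty}\Big((1)_{k,\lambda}H_{1,\lambda}+(2)_{k,\lambda}H_{2,\lambda}+\cdots+(n)_{k,\lambda}H_{n,\lambda}\Big)x^{n}=\frac{1}{(1-x)^{2}}\bigg(HF_{k,\lambda}\Big(\frac{x}{1-x}\Big)-\log_{\lambda}(1-x)F_{k,\lambda}^{(1-\lambda)}\Big(\frac{x}{1-x}\Big)\bigg).$$
   Context: Fix a nonzero real $\lambda$. All generating functions are formal power series, with $(1+u)^{a}=\sum_{j\ge0}\binom{a}{j}u^{j}$. Notation: $(x)_{0,\lambda}=1$ and $(x)_{n,\lambda}=x(x-\lambda)\cdots(x-(n-1)\lambda)$ for $n\ge1$. Degenerate logarithm: $\log_{\lambda}(1+t)=\frac{1}{\lambda}\big((1+t)^{\lambda}-1\big)$. Degenerate exponential: $e_{\lambda}(t)=(1+\lambda t)^{1/\lambda}=\sum_{n\ge0}(1)_{n,\lambda}\frac{t^{n}}{n!}$. Degenerate harmonic numbers $H_{n,\lambda}$: defined by $-\frac{\log_{\lambda}(1-t)}{1-t}=\sum_{n=1}^{\infty}H_{n,\lambda}t^{n}$. Degenerate harmonic-Fubini polynomials $HF_{n,\lambda}(x)$: defined by $$-\frac{\log_{\lambda}\big(1-x(e_{\lambda}(t)-1)\big)}{1-x(e_{\lambda}(t)-1)}=\sum_{n=1}^{\infty}HF_{n,\lambda}(x)\frac{t^{n}}{n!}.$$ For $\alpha\in\mathbb{R}$,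 the degenerate Fubini polynomials of order $\alpha$, $F_{n,\lambda}^{(\alpha)}(x)$, are defined by $$\bigg(\frac{1}{1-x(e_{\lambda}(t)-1)}\bigg)^{\alpha}=\sum_{n=0}^{\infty}F_{n,\lambda}^{(\alpha)}(x)\frac{t^{n}}{n!}.$$ *)

theory Defs
  imports "HOL-Computational_Algebra.Computational_Algebra"
begin

text \<open>
  The power \<open>f\<^sup>a = (\<Sum>j. (a gchoose j) (f - 1)\<^sup>j)\<close>, meaningful for series \<open>f\<close> with constant
  coefficient 1.
\<close>

definition fps_powr :: "real fps \<Rightarrow> real \<Rightarrow> real fps" where
  "fps_powr f a = fps_binomial a oo (f - 1)"

definition deg_falling :: "real \<Rightarrow> real \<Rightarrow> nat \<Rightarrow> real" where
  "deg_falling l x n = (\<Prod>i<n. x - of_nat i * l)"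

text \<open>
  The argument of \<open>deg_log\<close> is the whole series whose degenerate logarithm is taken (constant
  coefficient 1), so \<open>log\<^sub>\<lambda> (1 + t)\<close> is \<open>deg_log l (1 + fps_X)\<close>.
\<close>

definition deg_log :: "real \<Rightarrow> real fps \<Rightarrow> real fps" where
  "deg_log l f = fps_const (1 / l) * (fps_powr f l - 1)"

definition deg_exp :: "real \<Rightarrow> real fps" where
  "deg_exp l = fps_powr (1 + fps_const l * fps_X) (1 / l)"

definition deg_harmonic :: "real \<Rightarrow> nat \<Rightarrow> real" where
  "deg_harmonic l n = fps_nth (- deg_log l (1 - fps_X) / (1 - fps_X)) n"

text \<open>
  For a real series \<open>G\<close>, the series \<open>G (x (e\<^sub>\<lambda>(t) - 1))\<close> in \<open>t\<close> with coefficients in the ring of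
  real polynomials in \<open>x\<close>; the polynomial \<open>[:0, 1:]\<close> is the indeterminate \<open>x\<close>.
\<close>

definition fps_to_poly_fps :: "real fps \<Rightarrow> real poly fps" where
  "fps_to_poly_fps G = Abs_fps (\<lambda>n. [:fps_nth G n:])"

definition fubini_subst :: "real \<Rightarrow> real fps \<Rightarrow> real poly fps" where
  "fubini_subst l G =
     fps_to_poly_fps G oo (fps_const [:0, 1:] * fps_to_poly_fps (deg_exp l - 1))"

definition harmonic_fubini :: "real \<Rightarrow> nat \<Rightarrow> real poly" where
  "harmonic_fubini l n =
     smult (fact n) (fps_nth (fubini_subst l (- deg_log l (1 - fps_X) / (1 - fps_X))) n)"

definition deg_fubini :: "real \<Rightarrow> real \<Rightarrow> nat \<Rightarrow> real poly" where
  "deg_fubini l a n =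
     smult (fact n) (fps_nth (fubini_subst l (fps_powr (1 / (1 - fps_X)) a)) n)"

definition poly_at_fps :: "real poly \<Rightarrow> real fps \<Rightarrow> real fps" where
  "poly_at_fps p f = poly (map_poly fps_const p) f"

text \<open>
  At every real \<open>x\<close> the two polynomial families satisfy the generating-function identities in
  \<open>real fps\<close>, where the division is available: see \<open>harmonic_fubini_gf\<close> and \<open>deg_fubini_gf\<close>.
\<close>

definition fps_poly_eval :: "real \<Rightarrow> real poly fps \<Rightarrow> real fps" where
  "fps_poly_eval x F = Abs_fps (\<lambda>n. poly (fps_nth F n) x)"

lemma fps_poly_eval_mult: "fps_poly_eval x (F * G) = fps_poly_eval x F * fps_poly_eval x G"
  by (rule fps_ext) (simp add: fps_poly_eval_def fps_mult_nth poly_sum)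

lemma fps_poly_eval_power: "fps_poly_eval x (F ^ n) = fps_poly_eval x F ^ n"
proof (induction n)
  case 0
  show ?case by (rule fps_ext) (simp add: fps_poly_eval_def)
next
  case (Suc n)
  then show ?case by (simp add: fps_poly_eval_mult)
qed

lemma fps_poly_eval_compose: "fps_poly_eval x (F oo G) = fps_poly_eval x F oo fps_poly_eval x G"
proof (rule fps_ext)
  fix n
  have "poly (G ^ i $ n) x = fps_poly_eval x G ^ i $ n" for i
    by (simp add: fps_poly_eval_power [symmetric]) (simp add: fps_poly_eval_def)
  then show "fps_poly_eval x (F oo G) $ n = (fps_poly_eval x F oo fps_poly_eval x G) $ n"
    by (simp add: fps_compose_nth poly_sum) (simp add: fps_poly_eval_def fps_compose_nth poly_sum)
qed

lemma fps_poly_eval_fubini_subst: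
  "fps_poly_eval x (fubini_subst l G) = G oo (fps_const x * (deg_exp l - 1))"
proof -
  have *: "fps_poly_eval x (fps_to_poly_fps H) = H" for H
    by (rule fps_ext) (simp add: fps_poly_eval_def fps_to_poly_fps_def)
  have "fps_poly_eval x (fps_const [:0, 1:]) = fps_const x"
    by (rule fps_ext) (simp add: fps_poly_eval_def)
  with * show ?thesis
    by (simp add: fubini_subst_def fps_poly_eval_compose fps_poly_eval_mult)
qed

lemma deg_exp_nth: "fps_nth (deg_exp l) n = deg_falling l 1 n / fact n" if "l \<noteq> 0"
proof -
  have "(\<Prod>i<n. 1 - real i * l) = (\<Prod>i<n. l * (1 / l - real i))"
    by (rule prod.cong) (use that in \<open>auto simp: field_simps\<close>)
  also have "\<dots> = l ^ n * (\<Prod>i = 0..<n. 1 / l - real i)"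
    by (simp add: prod.distrib atLeast0LessThan)
  finally show ?thesis
    by (simp add: deg_exp_def fps_powr_def fps_compose_linear deg_falling_def
        gbinomial_prod_rev)
qed

lemma fps_powr_compose:
  assumes "f $ 0 = 1" "u $ 0 = 0"
  shows "fps_powr f a oo u = fps_powr (f oo u) a"
  using assms
  by (simp add: fps_powr_def fps_compose_assoc [symmetric] fps_compose_sub_distrib)

lemma deg_log_compose:
  assumes "f $ 0 = 1" "u $ 0 = 0"
  shows "deg_log l f oo u = deg_log l (f oo u)"
  using assms
  by (simp add: deg_log_def fps_compose_mult_distrib fps_compose_sub_distrib fps_powr_compose)

lemma deg_exp_0: "(deg_exp l - 1) $ 0 = 0"
  by (simp add: deg_exp_def fps_powr_def)

lemma harmonic_fubini_gf:
  fixes x l :: real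
  defines "u \<equiv> fps_const x * (deg_exp l - 1)"
  shows "Abs_fps (\<lambda>n. poly (harmonic_fubini l n) x / fact n) = - deg_log l (1 - u) / (1 - u)"
proof -
  have u: "u $ 0 = 0" using deg_exp_0 by (simp add: u_def)
  have "Abs_fps (\<lambda>n. poly (harmonic_fubini l n) x / fact n) =
        (- deg_log l (1 - fps_X) / (1 - fps_X)) oo u"
    unfolding u_def fps_poly_eval_fubini_subst [symmetric]
    by (rule fps_ext) (simp add: harmonic_fubini_def fps_poly_eval_def)
  also have "\<dots> = - deg_log l (1 - u) / (1 - u)"
    using u by (simp add: fps_divide_compose fps_compose_uminus deg_log_compose
        fps_compose_sub_distrib)
  finally show ?thesis .
qed

lemma deg_fubini_gf:
  fixes x l a :: real
  defines "u \<equiv> fps_const x * (deg_exp l - 1)"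
  shows "Abs_fps (\<lambda>n. poly (deg_fubini l a n) x / fact n) = fps_powr (1 / (1 - u)) a"
proof -
  have u: "u $ 0 = 0" using deg_exp_0 by (simp add: u_def)
  have "Abs_fps (\<lambda>n. poly (deg_fubini l a n) x / fact n) = fps_powr (1 / (1 - fps_X)) a oo u"
    unfolding u_def fps_poly_eval_fubini_subst [symmetric]
    by (rule fps_ext) (simp add: deg_fubini_def fps_poly_eval_def)
  also have "\<dots> = fps_powr (1 / (1 - u)) a"
    using u by (simp add: fps_powr_compose fps_divide_compose fps_compose_sub_distrib)
  finally show ?thesis .
qed

end

theory Submission
  imports Defs
begin

text \<open>
  Up to the factor \<open>k!\<close>, the \<open>k\<close>-th coefficient in \<open>t\<close> of \<open>G(x e\<^sub>\<lambda>(t))\<close> is the series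
  \<open>\<Sum>m. (m)\<^bsub>k,\<lambda>\<^esub> G\<^sub>m x\<^sup>m\<close>, because \<open>e\<^sub>\<lambda>(t)\<^sup>m\<close> generates the numbers \<open>(m)\<^bsub>k,\<lambda>\<^esub>\<close>. With
  \<open>y = x / (1 - x)\<close> one has \<open>1 - x e\<^sub>\<lambda>(t) = (1 - x) (1 - y (e\<^sub>\<lambda>(t) - 1))\<close>, so for \<open>G = (1 - x)\<^sup>a\<close>
  this series is \<open>(1 - x)\<^sup>a\<close> times the coefficient of \<open>(1 - y (e\<^sub>\<lambda>(t) - 1))\<^sup>a\<close>, a polynomial of
  Fubini type taken at \<open>y\<close>: lemma \<open>weighted_one_minus_powr\<close>. Both sides are linear in \<open>G\<close>, and the
  generating function of the harmonic numbers is a combination of two such powers,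
  \<open>- log\<^sub>\<lambda>(1 - x) / (1 - x) = ((1 - x)\<^bsup>-1\<^esup> - (1 - x)\<^bsup>\<lambda>-1\<^esup>) / \<lambda>\<close>. At \<open>y (e\<^sub>\<lambda>(t) - 1)\<close> in place
  of \<open>x\<close> the second of them generates the Fubini polynomials of order \<open>1 - \<lambda>\<close> taken at \<open>y\<close>, and
  the deviation of its prefactor
  \<open>(1 - x)\<^bsup>\<lambda>-1\<^esup> = (1 + \<lambda> log\<^sub>\<lambda>(1 - x)) / (1 - x)\<close> from \<open>1 / (1 - x)\<close> is the source of the logarithm
  in the theorem. The other factor \<open>1 / (1 - x)\<close> turns coefficients into partial sums.

  The factorisation above lives in two variables. It becomes a statement about series in \<open>x\<close> alone
  when the powers of \<open>e\<^sub>\<lambda>(t)\<close> are expanded in powers of \<open>e\<^sub>\<lambda>(t) - 1\<close>: if \<open>c\<^sub>i\<close> is \<open>k!\<close> times the \<open>k\<close>-th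
  coefficient of \<open>(e\<^sub>\<lambda>(t) - 1)\<^sup>i\<close>, then \<open>(m)\<^bsub>k,\<lambda>\<^esub> = (\<Sum>i\<le>k. c\<^sub>i (m choose i))\<close>, while the polynomial
  belonging to \<open>G\<close> is \<open>\<Sum>i\<le>k. c\<^sub>i G\<^sub>i x\<^sup>i\<close>. What remains to be compared for each \<open>i\<close> is the trinomial
  revision of binomial coefficients.
\<close>

lemma deg_exp_power:
  assumes "l \<noteq> 0"
  shows "deg_exp l ^ m $ k = deg_falling l (of_nat m) k / fact k"
proof -
  have "deg_exp l ^ m = fps_binomial (real m / l) oo (fps_const l * fps_X)"
    by (simp add: deg_exp_def fps_powr_def fps_compose_power fps_binomial_power)
  moreover have "(\<Prod>i<k. real m - real i * l) = (\<Prod>i<k. l * (real m / l - real i))"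
    by (rule prod.cong) (use assms in \<open>auto simp: field_simps\<close>)
  moreover have "\<dots> = l ^ k * (\<Prod>i = 0..<k. real m / l - real i)"
    by (simp add: prod.distrib atLeast0LessThan)
  ultimately show ?thesis
    by (simp add: fps_compose_linear deg_falling_def gbinomial_prod_rev)
qed

text \<open>These numbers are \<open>i!\<close> times the degenerate Stirling numbers of the second kind.\<close>

definition deg_surj :: "real \<Rightarrow> nat \<Rightarrow> nat \<Rightarrow> real" where
  "deg_surj l k i = fact k * ((deg_exp l - 1) ^ i $ k)"

text \<open>
  Compare coefficients in the binomial expansion of \<open>(1 + (e\<^sub>\<lambda>(t) - 1))\<^sup>m\<close>. The sum can stop at
  \<open>k\<close>, uniformly in \<open>m\<close>, because \<open>(e\<^sub>\<lambda>(t) - 1)\<^sup>i\<close> starts at degree \<open>i\<close>.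
\<close>

lemma deg_falling_eq_sum_binomial:
  assumes "l \<noteq> 0"
  shows "deg_falling l (of_nat m) k = (\<Sum>i\<le>k. deg_surj l k i * real (m choose i))"
proof -
  let ?E = "deg_exp l - 1"
  have "deg_falling l (of_nat m) k = fact k * ((?E + 1) ^ m $ k)"
    using deg_exp_power [OF assms, of m k] by simp
  also have "\<dots> = (\<Sum>i\<le>m. deg_surj l k i * real (m choose i))"
    unfolding binomial_ring
    by (simp add: fps_sum_nth sum_distrib_left deg_surj_def fps_of_nat [symmetric] mult_ac)
  also have "\<dots> = (\<Sum>i\<le>max m k. deg_surj l k i * real (m choose i))"
    by (rule sum.mono_neutral_left) auto
  also have "\<dots> = (\<Sum>i\<le>k. deg_surj l k i * real (m choose i))"
    using startsby_zero_power_prefix [OF deg_exp_0 [of l]]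
    by (intro sum.mono_neutral_right) (auto simp: deg_surj_def)
  finally show ?thesis .
qed

lemma poly_at_fps_add: "poly_at_fps (p + q) f = poly_at_fps p f + poly_at_fps q f"
proof -
  have "map_poly fps_const (p + q) = map_poly fps_const p + map_poly fps_const q"
    by (rule poly_eqI) (simp add: coeff_map_poly)
  then show ?thesis by (simp add: poly_at_fps_def)
qed

lemma poly_at_fps_sum: "poly_at_fps (\<Sum>i\<in>A. p i) f = (\<Sum>i\<in>A. poly_at_fps (p i) f)"
proof (induction A rule: infinite_finite_induct)
  case (insert x F)
  then show ?case by (simp add: poly_at_fps_add)
qed (simp_all add: poly_at_fps_def)

lemma poly_at_fps_monom: "poly_at_fps (monom c n) f = fps_const c * f ^ n"
  by (simp add: poly_at_fps_def map_poly_monom poly_monom)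

lemma fubini_subst_nth:
  "smult (fact k) (fubini_subst l G $ k) = (\<Sum>i\<le>k. monom (deg_surj l k i * G $ i) i)"
proof -
  have pow: "fps_to_poly_fps F ^ i = fps_to_poly_fps (F ^ i)" for F i
  proof (induction i)
    case 0
    show ?case by (rule fps_ext) (simp add: fps_to_poly_fps_def one_pCons)
  next
    case (Suc i)
    have "fps_to_poly_fps F * fps_to_poly_fps (F ^ i) = fps_to_poly_fps (F * F ^ i)"
    proof (rule fps_ext)
      fix n
      have "(\<Sum>j\<in>A. [:h j:]) = [:\<Sum>j\<in>A. h j:]" for A :: "nat set" and h :: "nat \<Rightarrow> real"
        by (induction A rule: infinite_finite_induct) auto
      then show "(fps_to_poly_fps F * fps_to_poly_fps (F ^ i)) $ n = fps_to_poly_fps (F * F ^ i) $ n"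
        by (simp add: fps_to_poly_fps_def fps_mult_nth mult.commute)
    qed
    with Suc show ?case by simp
  qed
  have x: "[:0, 1:] ^ i = monom (1 :: real) i" for i
    by (simp add: monom_altdef)
  have smult_sum_right: "smult c (\<Sum>i\<in>A. p i) = (\<Sum>i\<in>A. smult c (p i))"
    for c :: real and p :: "nat \<Rightarrow> real poly" and A
    by (rule poly_eqI) (simp add: coeff_sum sum_distrib_left)
  show ?thesis
    by (simp add: fubini_subst_def fps_compose_nth power_mult_distrib pow fps_const_power x
        smult_sum_right atLeast0AtMost)
       (simp add: fps_to_poly_fps_def deg_surj_def smult_monom mult_ac)
qed

lemma poly_at_fubini_subst:
  "poly_at_fps (smult (fact k) (fubini_subst l G $ k)) f =
     (\<Sum>i\<le>k. fps_const (deg_surj l k i * G $ i) * f ^ i)"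
  by (simp add: fubini_subst_nth poly_at_fps_sum poly_at_fps_monom)

definition one_minus_powr :: "real \<Rightarrow> real fps" where
  "one_minus_powr a = fps_powr (1 - fps_X) a"

lemma one_minus_powr_nth: "one_minus_powr a $ n = (-1) ^ n * (a gchoose n)"
  by (simp add: one_minus_powr_def fps_powr_def fps_compose_uminus')

lemma one_minus_powr_add: "one_minus_powr (a + b) = one_minus_powr a * one_minus_powr b"
  by (simp add: one_minus_powr_def fps_powr_def fps_binomial_add_mult fps_compose_mult_distrib)

lemma one_minus_powr_minus_one: "one_minus_powr (- 1) = 1 / (1 - fps_X)"
  by (simp add: one_minus_powr_def fps_powr_def fps_binomial_minus_one fps_inverse_compose
      fps_compose_add_distrib fps_divide_unit)

lemma one_minus_powr_diff_of_nat:
  "one_minus_powr (a - of_nat i) = one_minus_powr a * (1 / (1 - fps_X)) ^ i"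
proof (induction i)
  case (Suc i)
  then show ?case
    using one_minus_powr_add [of "a - of_nat i" "- 1"]
    by (simp add: one_minus_powr_minus_one algebra_simps)
qed simp

text \<open>Both sides solve \<open>(1 + x) f' = - a f\<close> with \<open>f(0) = 1\<close>.\<close>

lemma fps_powr_inverse_one_plus: "fps_powr (inverse (1 + fps_X)) a = fps_binomial (- a)"
proof -
  let ?u = "inverse (1 + fps_X) - 1 :: real fps"
  let ?A = "fps_binomial a oo ?u"
  have u0: "?u $ 0 = 0" by simp
  have unit: "(1 + fps_X :: real fps) * inverse (1 + fps_X) = 1"
    by (simp add: inverse_mult_eq_1')
  have du: "fps_deriv ?u = - (inverse (1 + fps_X))\<^sup>2"
    by (simp add: fps_inverse_deriv)
  have "(fps_deriv (fps_binomial a) oo ?u) = (fps_const a * fps_binomial a / (1 + fps_X)) oo ?u"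
    by (simp only: fps_binomial_deriv)
  also have "\<dots> = fps_const a * ?A / inverse (1 + fps_X)"
    using u0 by (simp add: fps_divide_compose fps_compose_mult_distrib fps_compose_add_distrib)
  also have "\<dots> = fps_const a * ?A * (1 + fps_X)"
    by (simp add: fps_divide_unit)
  finally have "fps_deriv ?A =
      fps_const a * ?A * ((1 + fps_X) * - (inverse (1 + fps_X))\<^sup>2)"
    by (simp only: fps_compose_deriv [OF u0] du mult.assoc)
  also have "(1 + fps_X) * - (inverse (1 + fps_X))\<^sup>2 = - inverse (1 + fps_X :: real fps)"
    using unit by (simp add: power2_eq_square flip: mult.assoc)
  finally have "fps_deriv ?A = fps_const (- a) * ?A / (1 + fps_X)"
    by (simp add: fps_divide_unit flip: fps_const_neg)
  then have "?A = fps_binomial (- a)"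
    by (intro iffD1 [OF fps_binomial_ODE_unique']) simp
  then show ?thesis by (simp add: fps_powr_def)
qed

lemma fps_powr_inverse_one_minus: "fps_powr (1 / (1 - fps_X)) a = one_minus_powr (- a)"
proof -
  have "inverse (1 + fps_X) oo - fps_X = (1 / (1 - fps_X) :: real fps)"
    by (simp add: fps_inverse_compose fps_compose_add_distrib fps_divide_unit)
  then have "fps_powr (1 / (1 - fps_X)) a = fps_powr (inverse (1 + fps_X)) a oo - fps_X"
    by (simp add: fps_powr_compose)
  then show ?thesis
    unfolding fps_powr_inverse_one_plus by (simp add: one_minus_powr_def fps_powr_def)
qed

text \<open>
  The one-variable form of \<open>(1 - x e)\<^sup>a = (1 - x)\<^sup>a (1 - y (e - 1))\<^sup>a\<close>, where \<open>e = e\<^sub>\<lambda>(t)\<close> and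
  \<open>y = x / (1 - x)\<close>. By the expansion of the weight \<open>(m)\<^bsub>k,\<lambda>\<^esub>\<close> into binomial coefficients it
  suffices that the weight \<open>m choose i\<close> turns \<open>(1 - x)\<^sup>a\<close> into its \<open>i\<close>-th coefficient times \<open>x\<^sup>i (1 - x)\<^bsup>a-i\<^esup>\<close>:
  this is \<open>x\<^sup>i / i!\<close> times the \<open>i\<close>-th derivative.
\<close>

lemma weighted_one_minus_powr:
  assumes "l \<noteq> 0"
  shows "Abs_fps (\<lambda>m. deg_falling l (of_nat m) k * one_minus_powr a $ m) =
    one_minus_powr a *
      poly_at_fps (smult (fact k) (fubini_subst l (one_minus_powr a) $ k)) (fps_X / (1 - fps_X))"
proof -
  have binomial_weight: "Abs_fps (\<lambda>m. real (m choose i) * one_minus_powr a $ m) =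
      fps_const (one_minus_powr a $ i) * (one_minus_powr a * (fps_X / (1 - fps_X)) ^ i)" for i
  proof -
    have "(fps_X / (1 - fps_X)) ^ i = fps_X ^ i * (1 / (1 - fps_X :: real fps)) ^ i"
      by (simp add: fps_divide_unit power_mult_distrib)
    moreover have "Abs_fps (\<lambda>m. real (m choose i) * one_minus_powr a $ m) =
        fps_const (one_minus_powr a $ i) * (fps_X ^ i * one_minus_powr (a - of_nat i))"
    proof (rule fps_ext)
      fix m
      show "Abs_fps (\<lambda>m. real (m choose i) * one_minus_powr a $ m) $ m =
        (fps_const (one_minus_powr a $ i) * (fps_X ^ i * one_minus_powr (a - of_nat i))) $ m"
      proof (cases "i \<le> m")
        case True
        then have "(- 1) ^ m = (- 1 :: real) ^ i * (- 1) ^ (m - i)"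
          by (simp flip: power_add)
        with True gbinomial_trinomial_revision [OF True, of a] show ?thesis
          by (simp add: one_minus_powr_nth fps_X_power_mult_nth binomial_gbinomial mult.commute)
      qed (simp add: fps_X_power_mult_nth)
    qed
    ultimately show ?thesis
      by (simp add: one_minus_powr_diff_of_nat mult_ac)
  qed
  have "Abs_fps (\<lambda>m. deg_falling l (of_nat m) k * one_minus_powr a $ m) =
      (\<Sum>i\<le>k. fps_const (deg_surj l k i) * Abs_fps (\<lambda>m. real (m choose i) * one_minus_powr a $ m))"
    by (rule fps_ext)
       (simp add: deg_falling_eq_sum_binomial [OF assms] fps_sum_nth sum_distrib_left mult_ac)
  also have "\<dots> = one_minus_powr a *
      (\<Sum>i\<le>k. fps_const (deg_surj l k i * one_minus_powr a $ i) * (fps_X / (1 - fps_X)) ^ i)"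
    unfolding binomial_weight sum_distrib_left fps_const_mult [symmetric] by (simp only: mult_ac)
  finally show ?thesis
    by (simp only: poly_at_fubini_subst)
qed

theorem theorem10:
  fixes l :: real and k :: nat
  assumes "l \<noteq> 0" and "k \<ge> 1"
  shows "Abs_fps (\<lambda>n. \<Sum>m = 1..n. deg_falling l (of_nat m) k * deg_harmonic l m) =
    1 / (1 - fps_X)\<^sup>2 *
      (poly_at_fps (harmonic_fubini l k) (fps_X / (1 - fps_X))
       - deg_log l (1 - fps_X) * poly_at_fps (deg_fubini l (1 - l) k) (fps_X / (1 - fps_X)))"
proof -
  (* Divided by k!, T G is the k-th coefficient in t of G (x e) and P G that of G (y (e - 1)),
     where e is the degenerate exponential and y = x / (1 - x). *)
  define P where "P G = poly_at_fps (smult (fact k) (fubini_subst l G $ k)) (fps_X / (1 - fps_X))"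
    for G
  define T where "T G = Abs_fps (\<lambda>m. deg_falling l (of_nat m) k * (G $ m :: real))" for G
  define G where "G = - deg_log l (1 - fps_X) / (1 - fps_X)"
  define D where "D = one_minus_powr (l - 1)"
  define E where "E = (1 / (1 - fps_X) :: real fps)"
  have log: "deg_log l (1 - fps_X) = fps_const (1 / l) * (one_minus_powr l - 1)"
    by (simp add: deg_log_def one_minus_powr_def)
  have D_eq: "D = one_minus_powr l * E"
    using one_minus_powr_add [of l "- 1"] by (simp add: D_def E_def one_minus_powr_minus_one)
  have "G = - deg_log l (1 - fps_X) * E"
    by (simp add: G_def E_def fps_divide_unit)
  then have G_eq: "G = fps_const (1 / l) * (E - D)"
    by (simp add: log D_eq algebra_simps)
  have T_G: "T G = fps_const (1 / l) * (T E - T D)"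
    by (rule fps_ext) (simp add: T_def G_eq algebra_simps)
  have G_nth: "fps_const (G $ i) = fps_const (1 / l) * (fps_const (E $ i) - fps_const (D $ i))" for i
    by (simp add: G_eq)
  have P_G: "P G = fps_const (1 / l) * (P E - P D)"
    unfolding P_def poly_at_fubini_subst sum_subtractf [symmetric] sum_distrib_left
    by (simp only: fps_const_mult [symmetric] G_nth algebra_simps)
  have "T D = D * P D" "T E = E * P E"
    using weighted_one_minus_powr [OF assms(1), of k "l - 1"]
      weighted_one_minus_powr [OF assms(1), of k "- 1"]
    by (simp_all add: T_def P_def D_def E_def one_minus_powr_minus_one)
  then have T_eq: "T G = E * (P G - deg_log l (1 - fps_X) * P D)"
    by (simp add: T_G P_G log D_eq algebra_simps)
  (* The partial sums in the statement start at 1, those produced by E start at 0. *)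
  have G0: "G $ 0 = 0"
    by (simp add: G_eq D_def E_def one_minus_powr_nth)
  have "Abs_fps (\<lambda>n. \<Sum>m = 1..n. deg_falling l (of_nat m) k * deg_harmonic l m) = T G * E"
  proof (rule fps_ext)
    fix n
    have "(\<Sum>m = 1..n. deg_falling l (of_nat m) k * G $ m) =
        (\<Sum>m = 0..n. deg_falling l (of_nat m) k * G $ m)"
      using G0 by (simp add: sum.atLeast_Suc_atMost)
    moreover have "T G * E = T G / (1 - fps_X)"
      by (simp add: E_def fps_divide_unit)
    moreover have "deg_harmonic l m = G $ m" for m
      by (simp only: deg_harmonic_def G_def)
    ultimately show "Abs_fps (\<lambda>n. \<Sum>m = 1..n. deg_falling l (of_nat m) k * deg_harmonic l m) $ n =
        (T G * E) $ n"
      by (simp add: T_def fps_divide_fps_X_minus1_sum)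
  qed
  also have "\<dots> = E ^ 2 * (P G - deg_log l (1 - fps_X) * P D)"
    by (simp add: T_eq power2_eq_square mult_ac)
  also have "E ^ 2 = 1 / (1 - fps_X)\<^sup>2"
    by (simp add: E_def fps_divide_unit power2_eq_square fps_inverse_mult)
  also have "P G = poly_at_fps (harmonic_fubini l k) (fps_X / (1 - fps_X))"
    by (simp add: P_def G_def harmonic_fubini_def)
  also have "P D = poly_at_fps (deg_fubini l (1 - l) k) (fps_X / (1 - fps_X))"
    by (simp add: P_def D_def deg_fubini_def fps_powr_inverse_one_minus)
  finally show ?thesis .
qed

end
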